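(* Let $G$ be a group, and let $R=\mathbb{Z}G_{\mathrm{ab}}$. The Torelli group $\mathcal{T}_G$ acts $R$-linearly on the Alexander invariant $B(G)$.
   Context: $G_{\mathrm{ab}}=G/G'$, and $\mathcal{T}_G=\ker(\mathrm{Aut}(G)\to\mathrm{Aut}(G_{\mathrm{ab}}))$ is the group of automorphisms of $G$ inducing the identity on $G_{\mathrm{ab}}$. The Alexander invariant is $B(G)=G'/G''$, where $G'=(G,G)$ and $G''=(G',G')$, with $R$-module structure $\bar h\cdot\bar g=\overline{hgh^{-1}}$ for $h\in G$, $g\in G'$. The group $\mathrm{Aut}(G)$ acts on $B(G)$ by $\alpha\cdot\bar x=\overline{\alpha(x)}$ for $x\in G'$, and $\mathcal{T}_G$ acts by restriction. *)

theory Defs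
  imports "HOL-Algebra.Algebra"
begin

text \<open>
  The integral group ring: finitely supported integer-valued functions on the carrier of a group,
  with the convolution product, i.e. the bilinear extension of the group operation.
\<close>

definition group_ring :: "('a, 'b) monoid_scheme \<Rightarrow> ('a \<Rightarrow>\<^sub>0 int) ring" where
  "group_ring A =
    \<lparr>carrier = {r. Poly_Mapping.keys r \<subseteq> carrier A},
     monoid.mult = (\<lambda>r s. frag_extend (\<lambda>x. frag_extend (\<lambda>y. frag_of (x \<otimes>\<^bsub>A\<^esub> y)) s) r),
     one = frag_of \<one>\<^bsub>A\<^esub>,
     ring.zero = 0,
     ring.add = (+)\<rparr>"

abbreviation derived_subgroup :: "('a, 'b) monoid_scheme \<Rightarrow> 'a set" where
  "derived_subgroup G \<equiv> derived G (carrier G)"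

abbreviation second_derived_subgroup :: "('a, 'b) monoid_scheme \<Rightarrow> 'a set" where
  "second_derived_subgroup G \<equiv> derived G (derived_subgroup G)"

definition abelianization :: "('a, 'b) monoid_scheme \<Rightarrow> 'a set monoid" where
  "abelianization G = G Mod derived_subgroup G"

text \<open>
  The self-map of a quotient induced by a map on representatives.  The union is over all
  representatives of a coset, so it is again a coset precisely when they all give the same one.
\<close>

definition quotient_map :: "('a, 'b) monoid_scheme \<Rightarrow> 'a set \<Rightarrow> ('a \<Rightarrow> 'a) \<Rightarrow> 'a set \<Rightarrow> 'a set" where
  "quotient_map A N f = (\<lambda>K \<in> carrier (A Mod N). \<Union>x\<in>K. N #>\<^bsub>A\<^esub> f x)"

definition Torelli_group :: "('a, 'b) monoid_scheme \<Rightarrow> ('a \<Rightarrow> 'a) monoid" where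
  "Torelli_group G =
    AutoGroup G
      \<lparr>carrier := kernel (AutoGroup G) (AutoGroup (abelianization G))
                   (quotient_map G (derived_subgroup G))\<rparr>"

text \<open>The quotient \<open>G'/G''\<close>, written multiplicatively.\<close>

definition Alexander_quotient :: "('a, 'b) monoid_scheme \<Rightarrow> 'a set monoid" where
  "Alexander_quotient G = G\<lparr>carrier := derived_subgroup G\<rparr> Mod second_derived_subgroup G"

text \<open>
  Conjugation of a class \<open>K\<close> in \<open>G'/G''\<close> by a class \<open>H\<close> in the abelianization, again as a union
  over all representatives.
\<close>

definition conj_class :: "('a, 'b) monoid_scheme \<Rightarrow> 'a set \<Rightarrow> 'a set \<Rightarrow> 'a set" where
  "conj_class G H K =
    (\<Union>h\<in>H. \<Union>g\<in>K. second_derived_subgroup G #>\<^bsub>G\<^esub> (h \<otimes>\<^bsub>G\<^esub> g \<otimes>\<^bsub>G\<^esub> inv\<^bsub>G\<^esub> h))"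

text \<open>
  The \<^const>\<open>module\<close> locale uses only the carrier, addition, zero and scalar multiplication of a
  module record; the ring fields \<open>mult\<close> and \<open>one\<close> are irrelevant.  Scalar multiplication is the
  additive extension of \<^const>\<open>conj_class\<close>, with addition in \<open>G'/G''\<close> still written
  multiplicatively on the right-hand side.
\<close>

definition Alexander_invariant :: "('a, 'b) monoid_scheme \<Rightarrow> ('a set \<Rightarrow>\<^sub>0 int, 'a set) module" where
  "Alexander_invariant G = (let B = Alexander_quotient G in
    \<lparr>carrier = carrier B,
     monoid.mult = undefined,
     one = undefined,
     ring.zero = \<one>\<^bsub>B\<^esub>,
     ring.add = (\<lambda>K L. K \<otimes>\<^bsub>B\<^esub> L),
     smult = (\<lambda>r K. \<Otimes>\<^bsub>B\<^esub>H\<in>Poly_Mapping.keys r. conj_class G H K [^]\<^bsub>B\<^esub> Poly_Mapping.lookup r H)\<rparr>)"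

definition Alexander_action :: "('a, 'b) monoid_scheme \<Rightarrow> ('a \<Rightarrow> 'a) \<Rightarrow> 'a set \<Rightarrow> 'a set" where
  "Alexander_action G = quotient_map (G\<lparr>carrier := derived_subgroup G\<rparr>) (second_derived_subgroup G)"

definition acts_linearly ::
  "('t, 'u) monoid_scheme \<Rightarrow> ('r, 's) ring_scheme \<Rightarrow> ('r, 'm, 'n) module_scheme
    \<Rightarrow> ('t \<Rightarrow> 'm \<Rightarrow> 'm) \<Rightarrow> bool" where
  "acts_linearly T R M \<phi> \<longleftrightarrow>
    module R M \<and>
    group_action T (carrier M) \<phi> \<and>
    (\<forall>t \<in> carrier T. \<forall>x \<in> carrier M. \<forall>y \<in> carrier M.
      \<phi> t (x \<oplus>\<^bsub>M\<^esub> y) = \<phi> t x \<oplus>\<^bsub>M\<^esub> \<phi> t y) \<and>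
    (\<forall>t \<in> carrier T. \<forall>r \<in> carrier R. \<forall>x \<in> carrier M.
      \<phi> t (r \<odot>\<^bsub>M\<^esub> x) = r \<odot>\<^bsub>M\<^esub> \<phi> t x)"

text \<open>Independence of representatives.\<close>

lemma UN_eq_const: "a \<in> K \<Longrightarrow> (\<And>y. y \<in> K \<Longrightarrow> F y = C) \<Longrightarrow> (\<Union>y\<in>K. F y) = C"
  by auto

lemma quotient_map_coset:
  assumes N: "N \<lhd> A" and f: "f \<in> hom A A" and fN: "f ` N \<subseteq> N" and x: "x \<in> carrier A"
  shows "quotient_map A N f (N #>\<^bsub>A\<^esub> x) = N #>\<^bsub>A\<^esub> f x"
proof -
  interpret normal N A by (rule N)
  have N_sub: "subgroup N A" by (rule is_subgroup)
  have fx: "f x \<in> carrier A" using f x by (auto simp: hom_def)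
  have "N #>\<^bsub>A\<^esub> f y = N #>\<^bsub>A\<^esub> f x" if y: "y \<in> N #>\<^bsub>A\<^esub> x" for y
  proof -
    obtain n where n: "n \<in> N" "y = n \<otimes>\<^bsub>A\<^esub> x"
      using y by (auto simp: r_coset_def)
    then have "f y = f n \<otimes>\<^bsub>A\<^esub> f x"
      using f x subset by (auto simp: hom_def)
    moreover have "f n \<in> N" using fN n by auto
    ultimately have "f y \<in> N #>\<^bsub>A\<^esub> f x" by (auto simp: r_coset_def)
    then show ?thesis using repr_independence[OF _ fx N_sub] by simp
  qed
  then have "(\<Union>y\<in>N #>\<^bsub>A\<^esub> x. N #>\<^bsub>A\<^esub> f y) = N #>\<^bsub>A\<^esub> f x"
    by (rule UN_eq_const[OF rcos_self[OF x N_sub]])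
  moreover have "N #>\<^bsub>A\<^esub> x \<in> carrier (A Mod N)"
    using x by (auto simp: carrier_FactGroup)
  ultimately show ?thesis by (simp add: quotient_map_def)
qed

lemma Alexander_action_coset:
  assumes G: "group G" and \<alpha>: "\<alpha> \<in> auto G" and x: "x \<in> derived_subgroup G"
  shows "Alexander_action G \<alpha> (second_derived_subgroup G #>\<^bsub>G\<^esub> x)
    = second_derived_subgroup G #>\<^bsub>G\<^esub> \<alpha> x"
proof -
  interpret group G by (rule G)
  let ?D = "derived_subgroup G" and ?E = "second_derived_subgroup G"
  let ?A = "G\<lparr>carrier := ?D\<rparr>"
  have D: "subgroup ?D G" by (rule derived_is_subgroup) simp
  interpret A: group ?A using subgroup.subgroup_is_group[OF D G] .
  have E: "?E = derived ?A (carrier ?A)"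
    using derived_consistent[OF subset_refl D] by simp
  have hom: "\<alpha> \<in> hom G G" and surj: "\<alpha> ` carrier G = carrier G"
    using \<alpha> by (auto simp: auto_def Bij_def bij_betw_def)
  interpret h: group_hom G G \<alpha> by unfold_locales (rule hom)
  have imD: "\<alpha> ` ?D = ?D" using h.derived_img[of "carrier G"] surj by simp
  have imE: "\<alpha> ` ?E = ?E" using h.derived_img[of ?D] D imD by (simp add: subgroup.subset)
  have "quotient_map ?A ?E \<alpha> (?E #>\<^bsub>?A\<^esub> x) = ?E #>\<^bsub>?A\<^esub> \<alpha> x"
  proof (rule quotient_map_coset)
    show "?E \<lhd> ?A" unfolding E by (rule A.derived_self_is_normal)
    show "\<alpha> \<in> hom ?A ?A"
    proof (rule homI)
      show "\<alpha> y \<in> carrier ?A" if "y \<in> carrier ?A" for y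
        using imageI[of y ?D \<alpha>] that unfolding imD by simp
      show "\<alpha> (y \<otimes>\<^bsub>?A\<^esub> z) = \<alpha> y \<otimes>\<^bsub>?A\<^esub> \<alpha> z" if "y \<in> carrier ?A" "z \<in> carrier ?A" for y z
        using that h.hom_mult subgroup.mem_carrier[OF D] by simp
    qed
    show "\<alpha> ` ?E \<subseteq> ?E" by (rule equalityD1[OF imE])
    show "x \<in> carrier ?A" using x by simp
  qed
  then show ?thesis by (simp add: Alexander_action_def r_coset_def)
qed

lemma conj_class_coset:
  assumes G: "group G" and h: "h \<in> carrier G" and g: "g \<in> derived_subgroup G"
  shows "conj_class G (derived_subgroup G #>\<^bsub>G\<^esub> h) (second_derived_subgroup G #>\<^bsub>G\<^esub> g)
    = second_derived_subgroup G #>\<^bsub>G\<^esub> (h \<otimes>\<^bsub>G\<^esub> g \<otimes>\<^bsub>G\<^esub> inv\<^bsub>G\<^esub> h)"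
proof -
  interpret group G by (rule G)
  let ?D = "derived_subgroup G" and ?E = "second_derived_subgroup G"
  have D: "subgroup ?D G" by (rule derived_is_subgroup) simp
  have E: "subgroup ?E G" by (rule derived_is_subgroup) (rule subgroup.subset[OF D])
  interpret D: normal ?D G by (rule derived_self_is_normal)
  interpret E: normal ?E G by (rule derived_is_normal) (rule derived_self_is_normal)
  have gc: "g \<in> carrier G" using g D.subset by auto
  have *: "?E #>\<^bsub>G\<^esub> (h' \<otimes>\<^bsub>G\<^esub> g' \<otimes>\<^bsub>G\<^esub> inv\<^bsub>G\<^esub> h') = ?E #>\<^bsub>G\<^esub> (h \<otimes>\<^bsub>G\<^esub> g \<otimes>\<^bsub>G\<^esub> inv\<^bsub>G\<^esub> h)"
    if h': "h' \<in> ?D #>\<^bsub>G\<^esub> h" and g': "g' \<in> ?E #>\<^bsub>G\<^esub> g" for h' g'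
  proof -
    obtain c where c: "c \<in> ?D" "h' = c \<otimes>\<^bsub>G\<^esub> h" using h' by (auto simp: r_coset_def)
    obtain d where d: "d \<in> ?E" "g' = d \<otimes>\<^bsub>G\<^esub> g" using g' by (auto simp: r_coset_def)
    have cc: "c \<in> carrier G" "d \<in> carrier G" using c d D.subset E.subset by auto
    let ?x = "h \<otimes>\<^bsub>G\<^esub> g \<otimes>\<^bsub>G\<^esub> inv\<^bsub>G\<^esub> h"
    have x: "?x \<in> ?D" using D.inv_op_closed2[OF h g] .
    have xc: "?x \<in> carrier G" using h gc by simp
    have comm: "c \<otimes>\<^bsub>G\<^esub> ?x \<otimes>\<^bsub>G\<^esub> inv\<^bsub>G\<^esub> c \<otimes>\<^bsub>G\<^esub> inv\<^bsub>G\<^esub> ?x \<in> ?E"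
      unfolding derived_def[of G "derived_subgroup G"] using c x by (blast intro: generate.incl)
    let ?k = "h' \<otimes>\<^bsub>G\<^esub> d \<otimes>\<^bsub>G\<^esub> inv\<^bsub>G\<^esub> h'"
    have h'c: "h' \<in> carrier G" using c cc h by simp
    have k: "?k \<in> ?E" using E.inv_op_closed2[OF h'c d(1)] .
    have cancel: "inv\<^bsub>G\<^esub> y \<otimes>\<^bsub>G\<^esub> (y \<otimes>\<^bsub>G\<^esub> z) = z" "y \<otimes>\<^bsub>G\<^esub> (inv\<^bsub>G\<^esub> y \<otimes>\<^bsub>G\<^esub> z) = z"
      if "y \<in> carrier G" "z \<in> carrier G" for y z
      using that m_assoc[of "inv\<^bsub>G\<^esub> y" y z] m_assoc[of y "inv\<^bsub>G\<^esub> y" z] by auto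
    have "h' \<otimes>\<^bsub>G\<^esub> g' \<otimes>\<^bsub>G\<^esub> inv\<^bsub>G\<^esub> h' =
      (?k \<otimes>\<^bsub>G\<^esub> (c \<otimes>\<^bsub>G\<^esub> ?x \<otimes>\<^bsub>G\<^esub> inv\<^bsub>G\<^esub> c \<otimes>\<^bsub>G\<^esub> inv\<^bsub>G\<^esub> ?x)) \<otimes>\<^bsub>G\<^esub> ?x"
      using cc h gc by (simp add: c(2) d(2) m_assoc inv_mult_group cancel)
    moreover have "?k \<otimes>\<^bsub>G\<^esub> (c \<otimes>\<^bsub>G\<^esub> ?x \<otimes>\<^bsub>G\<^esub> inv\<^bsub>G\<^esub> c \<otimes>\<^bsub>G\<^esub> inv\<^bsub>G\<^esub> ?x) \<in> ?E"
      using k comm by (rule E.m_closed)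
    ultimately have "h' \<otimes>\<^bsub>G\<^esub> g' \<otimes>\<^bsub>G\<^esub> inv\<^bsub>G\<^esub> h' \<in> ?E #>\<^bsub>G\<^esub> ?x"
      unfolding r_coset_def by blast
    then show ?thesis using repr_independence[OF _ xc E] by simp
  qed
  have "(\<Union>g'\<in>?E #>\<^bsub>G\<^esub> g. ?E #>\<^bsub>G\<^esub> (h' \<otimes>\<^bsub>G\<^esub> g' \<otimes>\<^bsub>G\<^esub> inv\<^bsub>G\<^esub> h'))
      = ?E #>\<^bsub>G\<^esub> (h \<otimes>\<^bsub>G\<^esub> g \<otimes>\<^bsub>G\<^esub> inv\<^bsub>G\<^esub> h)"
    if "h' \<in> ?D #>\<^bsub>G\<^esub> h" for h'
    by (rule UN_eq_const[OF rcos_self[OF gc E]]) (rule *[OF that])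
  then show ?thesis
    unfolding conj_class_def by (rule UN_eq_const[OF rcos_self[OF h D]])
qed

end

theory Submission
  imports Defs
begin

text \<open>
  An automorphism \<open>\<alpha>\<close> sends \<open>h g h\<^sup>-\<^sup>1\<close> to \<open>\<alpha>(h) \<alpha>(g) \<alpha>(h)\<^sup>-\<^sup>1\<close>, so it intertwines the action of the class of
  \<open>h\<close> on \<open>G'/G''\<close> with that of the class of \<open>\<alpha>(h)\<close>.  If \<open>\<alpha>\<close> is in the Torelli group, these two
  classes agree, so \<open>\<alpha>\<close> commutes with the generators of the group ring.  As it acts additively, it
  commutes with their integral linear combinations.
\<close>

section \<open>Linear extension of maps into an abelian group\<close>

text \<open>The homomorphism from a free abelian group to the abelian group \<open>B\<close>,
  written multiplicatively, that extends \<open>f\<close>. Scalar multiplication on the Alexander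
  invariant is the case where \<open>f\<close> sends \<open>H\<close> to
  \<open>conj_class G H K\<close>.\<close>

definition linear_extension :: "('b, 'm) monoid_scheme \<Rightarrow> ('a \<Rightarrow> 'b) \<Rightarrow> ('a \<Rightarrow>\<^sub>0 int) \<Rightarrow> 'b" where
  "linear_extension B f r = (\<Otimes>\<^bsub>B\<^esub>h\<in>Poly_Mapping.keys r. f h [^]\<^bsub>B\<^esub> Poly_Mapping.lookup r h)"

context comm_group
begin

text \<open>Indices outside the support contribute zeroth powers. This allows several combinations
  to be written over one index set.\<close>

lemma linear_extension_superset:
  assumes "finite T" "Poly_Mapping.keys r \<subseteq> T" "f \<in> T \<rightarrow> carrier G"
  shows "linear_extension G f r = (\<Otimes>h\<in>T. f h [^] Poly_Mapping.lookup r h)"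
  unfolding linear_extension_def
  by (rule finprod_mono_neutral_cong_left) (use assms in \<open>auto simp: in_keys_iff Pi_iff\<close>)

lemma linear_extension_closed:
  assumes "f \<in> Poly_Mapping.keys r \<rightarrow> carrier G"
  shows "linear_extension G f r \<in> carrier G"
  unfolding linear_extension_def by (rule finprod_closed) (use assms in auto)

text \<open>Over the union of both supports the exponents add termwise. Cancellation may make the
  support of \<open>r + s\<close> smaller than this union, which is why a common superset is
  used.\<close>

lemma linear_extension_add:
  assumes "f \<in> Poly_Mapping.keys r \<union> Poly_Mapping.keys s \<rightarrow> carrier G"
  shows "linear_extension G f (r + s) = linear_extension G f r \<otimes> linear_extension G f s"
proof -
  let ?T = "Poly_Mapping.keys r \<union> Poly_Mapping.keys s"
  have f: "f h \<in> carrier G" if "h \<in> ?T" for h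
    using assms that by blast
  have "linear_extension G f (r + s) = (\<Otimes>h\<in>?T. f h [^] Poly_Mapping.lookup (r + s) h)"
    by (rule linear_extension_superset) (use assms keys_add[of r s] in auto)
  also have "\<dots> = (\<Otimes>h\<in>?T. f h [^] Poly_Mapping.lookup r h \<otimes> f h [^] Poly_Mapping.lookup s h)"
    by (rule finprod_cong') (use f in \<open>auto simp: Poly_Mapping.lookup_add int_pow_mult\<close>)
  also have "\<dots> = (\<Otimes>h\<in>?T. f h [^] Poly_Mapping.lookup r h)
      \<otimes> (\<Otimes>h\<in>?T. f h [^] Poly_Mapping.lookup s h)"
    by (rule finprod_multf) (use f in auto)
  finally show ?thesis
    using assms by (simp add: linear_extension_superset[of ?T])
qed

lemma linear_extension_0: "linear_extension G f 0 = \<one>"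
  by (simp add: linear_extension_def)

lemma linear_extension_of:
  "f a \<in> carrier G \<Longrightarrow> linear_extension G f (frag_of a) = f a"
  by (simp add: linear_extension_def)

text \<open>Apply additivity to \<open>(r - s) + s\<close> and solve for the first factor.
  Differences are the inductive step of \<open>free_Abelian_group_induct\<close>, on which the later
  extension lemmas rest.\<close>

lemma linear_extension_diff:
  assumes "f \<in> S \<rightarrow> carrier G" "Poly_Mapping.keys r \<subseteq> S" "Poly_Mapping.keys s \<subseteq> S"
  shows "linear_extension G f (r - s) = linear_extension G f r \<otimes> inv (linear_extension G f s)"
proof -
  have rs: "Poly_Mapping.keys (r - s) \<subseteq> S"
    using keys_diff[of r s] assms by blast
  have "linear_extension G f (r - s + s) = linear_extension G f (r - s) \<otimes> linear_extension G f s"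
    by (rule linear_extension_add) (use assms rs in auto)
  moreover have "linear_extension G f t \<in> carrier G" if "Poly_Mapping.keys t \<subseteq> S" for t
    by (rule linear_extension_closed) (use assms that in auto)
  ultimately show ?thesis
    using rs assms by (simp add: inv_solve_right)
qed

lemma linear_extension_cong:
  assumes "g \<in> Poly_Mapping.keys r \<rightarrow> carrier G" "\<And>h. h \<in> Poly_Mapping.keys r \<Longrightarrow> f h = g h"
  shows "linear_extension G f r = linear_extension G g r"
  unfolding linear_extension_def by (rule finprod_cong') (use assms in auto)

lemma linear_extension_mult:
  assumes "f \<in> Poly_Mapping.keys r \<rightarrow> carrier G" "g \<in> Poly_Mapping.keys r \<rightarrow> carrier G"
  shows "linear_extension G (\<lambda>h. f h \<otimes> g h) r = linear_extension G f r \<otimes> linear_extension G g r"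
proof -
  have "linear_extension G (\<lambda>h. f h \<otimes> g h) r = (\<Otimes>h\<in>Poly_Mapping.keys r.
      f h [^] Poly_Mapping.lookup r h \<otimes> g h [^] Poly_Mapping.lookup r h)"
    unfolding linear_extension_def
    by (rule finprod_cong') (use assms in \<open>auto intro!: int_pow_distrib\<close>)
  also have "\<dots> = linear_extension G f r \<otimes> linear_extension G g r"
    unfolding linear_extension_def by (rule finprod_multf) (use assms in auto)
  finally show ?thesis .
qed

text \<open>Both sides turn differences in \<open>r\<close> into quotients and agree on
  generators.\<close>

lemma hom_linear_extension:
  assumes \<phi>: "\<phi> \<in> hom G G" and f: "f \<in> Poly_Mapping.keys r \<rightarrow> carrier G"
  shows "\<phi> (linear_extension G f r) = linear_extension G (\<lambda>h. \<phi> (f h)) r"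
proof -
  interpret \<phi>: group_hom G G \<phi> by unfold_locales (rule \<phi>)
  have \<phi>f: "(\<lambda>h. \<phi> (f h)) \<in> Poly_Mapping.keys r \<rightarrow> carrier G"
    using f by (simp add: Pi_iff)
  show ?thesis
  \<comment> \<open>The induction runs over all combinations supported in the fixed set of keys of
    \<open>r\<close>, where the values of \<open>f\<close> are known to lie in the carrier.\<close>
  proof (rule free_Abelian_group_induct[OF subset_refl[of "Poly_Mapping.keys r"]])
    fix s t
    assume st: "Poly_Mapping.keys s \<subseteq> Poly_Mapping.keys r" "Poly_Mapping.keys t \<subseteq> Poly_Mapping.keys r"
      and IH: "\<phi> (linear_extension G f s) = linear_extension G (\<lambda>h. \<phi> (f h)) s"
        "\<phi> (linear_extension G f t) = linear_extension G (\<lambda>h. \<phi> (f h)) t"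
    have "linear_extension G f s \<in> carrier G" "linear_extension G f t \<in> carrier G"
      by (rule linear_extension_closed, use f st in blast)+
    then show "\<phi> (linear_extension G f (s - t)) = linear_extension G (\<lambda>h. \<phi> (f h)) (s - t)"
      using linear_extension_diff[OF f st] linear_extension_diff[OF \<phi>f st] IH by simp
  qed (use f in \<open>auto simp: linear_extension_0 linear_extension_of Pi_iff\<close>)
qed

text \<open>Both sides are homomorphisms in \<open>r\<close> that agree on generators. When
  \<open>g h\<close> is the translate of a ring element by \<open>h\<close>, the left side evaluates
  a convolution product, so this is the source of associativity of scalar multiplication.\<close>

lemma linear_extension_frag_extend:
  assumes r: "Poly_Mapping.keys r \<subseteq> S" and g: "\<And>h. h \<in> S \<Longrightarrow> Poly_Mapping.keys (g h) \<subseteq> T"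
    and f: "f \<in> T \<rightarrow> carrier G"
  shows "linear_extension G f (frag_extend g r) = linear_extension G (\<lambda>h. linear_extension G f (g h)) r"
proof -
  let ?F = "\<lambda>h. linear_extension G f (g h)"
  have F: "?F \<in> S \<rightarrow> carrier G"
    by (intro funcsetI linear_extension_closed) (use g f in blast)
  have keys: "Poly_Mapping.keys (frag_extend g s) \<subseteq> T" if "Poly_Mapping.keys s \<subseteq> S" for s
    using keys_frag_extend[of g s] g that by blast
  show ?thesis
  proof (rule free_Abelian_group_induct[OF r])
    fix s t
    assume st: "Poly_Mapping.keys s \<subseteq> S" "Poly_Mapping.keys t \<subseteq> S"
      and IH: "linear_extension G f (frag_extend g s) = linear_extension G ?F s"
        "linear_extension G f (frag_extend g t) = linear_extension G ?F t"
    show "linear_extension G f (frag_extend g (s - t)) = linear_extension G ?F (s - t)"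
      using linear_extension_diff[OF f keys[OF st(1)] keys[OF st(2)]] linear_extension_diff[OF F st] IH
      by (simp add: frag_extend_diff)
  next
    show "linear_extension G f (frag_extend g (frag_of a)) = linear_extension G ?F (frag_of a)"
      if "a \<in> S" for a
      using that F by (simp add: linear_extension_of Pi_iff)
  qed (simp add: linear_extension_0)
qed

end

section \<open>Modules over the group ring\<close>

text \<open>The product of \<open>group_ring\<close>, stated apart from the ring record so that
  inductions on supports apply to it directly.\<close>

abbreviation convolution ::
  "('a, 'b) monoid_scheme \<Rightarrow> ('a \<Rightarrow>\<^sub>0 int) \<Rightarrow> ('a \<Rightarrow>\<^sub>0 int) \<Rightarrow> 'a \<Rightarrow>\<^sub>0 int" where
  "convolution A r s \<equiv> frag_extend (\<lambda>x. frag_extend (\<lambda>y. frag_of (x \<otimes>\<^bsub>A\<^esub> y)) s) r"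

lemma convolution_diff_left: "convolution A (r - r') s = convolution A r s - convolution A r' s"
  by (rule frag_extend_diff)

text \<open>The right factor sits inside the outer extension, so linearity in it needs an induction
  on the left factor.\<close>

lemma convolution_diff_right: "convolution A r (s - s') = convolution A r s - convolution A r s'"
  by (induction r rule: frag_induction[OF subset_UNIV]) (auto simp: frag_extend_diff)

lemma keys_frag_extend_subset:
  assumes "\<And>x. x \<in> Poly_Mapping.keys c \<Longrightarrow> Poly_Mapping.keys (f x) \<subseteq> S"
  shows "Poly_Mapping.keys (frag_extend f c) \<subseteq> S"
  by (rule order_trans[OF keys_frag_extend]) (rule UN_least[OF assms])

lemma (in monoid) keys_convolution:
  assumes "Poly_Mapping.keys r \<subseteq> carrier G" "Poly_Mapping.keys s \<subseteq> carrier G"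
  shows "Poly_Mapping.keys (convolution G r s) \<subseteq> carrier G"
proof (intro keys_frag_extend_subset)
  show "Poly_Mapping.keys (frag_of (x \<otimes> y)) \<subseteq> carrier G"
    if "x \<in> Poly_Mapping.keys r" "y \<in> Poly_Mapping.keys s" for x y
    using assms that by auto
qed

text \<open>By bilinearity it suffices to compare two generators, where commutativity of the monoid
  applies.\<close>

lemma (in comm_monoid) convolution_comm:
  assumes r: "Poly_Mapping.keys r \<subseteq> carrier G" and s: "Poly_Mapping.keys s \<subseteq> carrier G"
  shows "convolution G r s = convolution G s r"
proof (rule free_Abelian_group_induct[OF r])
  show "convolution G (frag_of a) s = convolution G s (frag_of a)" if a: "a \<in> carrier G" for a
    by (rule free_Abelian_group_induct[OF s])
      (use a in \<open>simp_all add: frag_extend_diff m_comm\<close>)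
qed (simp_all add: convolution_diff_left convolution_diff_right frag_extend_eq_0)

text \<open>Linearity in each of the three factors reduces the claim to associativity on
  generators.\<close>

lemma (in monoid) convolution_assoc:
  assumes r: "Poly_Mapping.keys r \<subseteq> carrier G" and s: "Poly_Mapping.keys s \<subseteq> carrier G"
    and t: "Poly_Mapping.keys t \<subseteq> carrier G"
  shows "convolution G (convolution G r s) t = convolution G r (convolution G s t)"
proof (rule free_Abelian_group_induct[OF r])
  fix a assume a: "a \<in> carrier G"
  show "convolution G (convolution G (frag_of a) s) t = convolution G (frag_of a) (convolution G s t)"
  proof (rule free_Abelian_group_induct[OF s])
    fix b assume b: "b \<in> carrier G"
    show "convolution G (convolution G (frag_of a) (frag_of b)) t
        = convolution G (frag_of a) (convolution G (frag_of b) t)"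
      by (rule free_Abelian_group_induct[OF t])
        (use a b in \<open>simp_all add: frag_extend_diff m_assoc\<close>)
  qed (simp_all add: frag_extend_diff)
qed (simp_all add: frag_extend_diff)

lemma cring_group_ring:
  assumes "comm_group A"
  shows "cring (group_ring A)"
proof -
  interpret comm_group A by (rule assms)
  \<comment> \<open>The unit law of \<open>A\<close> applies only to elements of its carrier, hence
    the condition on the support.\<close>
  have one: "frag_extend (\<lambda>y. frag_of (\<one>\<^bsub>A\<^esub> \<otimes>\<^bsub>A\<^esub> y)) r = r" if "Poly_Mapping.keys r \<subseteq> carrier A" for r
    by (rule free_Abelian_group_induct[OF that]) (simp_all add: frag_extend_diff)
  show ?thesis
  proof (rule cringI)
    show "abelian_group (group_ring A)"
    proof (rule abelian_groupI)
      show "\<exists>s\<in>carrier (group_ring A). s \<oplus>\<^bsub>group_ring A\<^esub> r = \<zero>\<^bsub>group_ring A\<^esub>"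
        if "r \<in> carrier (group_ring A)" for r
        by (rule bexI[of _ "- r"]) (use that in \<open>auto simp: group_ring_def keys_minus\<close>)
    qed (auto simp: group_ring_def add.assoc add.commute dest: subsetD[OF keys_add])
    show "comm_monoid (group_ring A)"
      by (rule comm_monoidI)
        (use keys_convolution in \<open>auto simp: group_ring_def one convolution_assoc intro: convolution_comm\<close>)
  qed (simp add: group_ring_def frag_extend_add)
qed

text \<open>An action \<open>c\<close> of an abelian group \<open>A\<close> by endomorphisms of an
  abelian group \<open>B\<close> extends linearly to the integral group ring. The record
  \<open>M\<close> is tied to \<open>B\<close> through its fields, which translates the
  multiplicative notation of \<open>B\<close> into the additive notation of modules.\<close>

lemma module_group_ring:
  fixes A :: "('a, 'b) monoid_scheme" and M :: "('a \<Rightarrow>\<^sub>0 int, 'm, 'n) module_scheme"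
  assumes A: "comm_group A" and B: "comm_group B"
    and M: "carrier M = carrier B" "\<zero>\<^bsub>M\<^esub> = \<one>\<^bsub>B\<^esub>" "add M = monoid.mult B"
      "\<And>r x. r \<odot>\<^bsub>M\<^esub> x = linear_extension B (\<lambda>h. c h x) r"
    and hom: "\<And>h. h \<in> carrier A \<Longrightarrow> c h \<in> hom B B"
    and one: "\<And>x. x \<in> carrier B \<Longrightarrow> c \<one>\<^bsub>A\<^esub> x = x"
    and mult: "\<And>h k x. h \<in> carrier A \<Longrightarrow> k \<in> carrier A \<Longrightarrow> x \<in> carrier B
      \<Longrightarrow> c (h \<otimes>\<^bsub>A\<^esub> k) x = c h (c k x)"
  shows "module (group_ring A) M"
proof -
  interpret A: comm_group A by (rule A)
  interpret B: comm_group B by (rule B)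
  have c: "(\<lambda>h. c h x) \<in> carrier A \<rightarrow> carrier B" if "x \<in> carrier B" for x
    using hom that by (auto simp: hom_def)
  then have c': "(\<lambda>h. c h x) \<in> Poly_Mapping.keys r \<rightarrow> carrier B"
    if "Poly_Mapping.keys r \<subseteq> carrier A" "x \<in> carrier B" for r x
    using that by blast
  note carrier = group_ring_def[of A]
  show ?thesis
  proof (rule moduleI)
    show "cring (group_ring A)" using A by (rule cring_group_ring)
    show "abelian_group M"
    proof (rule abelian_groupI)
      show "\<exists>y\<in>carrier M. y \<oplus>\<^bsub>M\<^esub> x = \<zero>\<^bsub>M\<^esub>" if "x \<in> carrier M" for x
        using that by (auto simp: M intro!: bexI[of _ "inv\<^bsub>B\<^esub> x"])
    qed (auto simp: M B.m_ac)
    show "\<one>\<^bsub>group_ring A\<^esub> \<odot>\<^bsub>M\<^esub> x = x" if "x \<in> carrier M" for x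
      using that by (simp add: M carrier B.linear_extension_of one)
    fix r x assume r: "r \<in> carrier (group_ring A)" and x: "x \<in> carrier M"
    show "r \<odot>\<^bsub>M\<^esub> x \<in> carrier M"
      using r x by (simp add: M carrier B.linear_extension_closed c')
    show "(r \<oplus>\<^bsub>group_ring A\<^esub> s) \<odot>\<^bsub>M\<^esub> x = r \<odot>\<^bsub>M\<^esub> x \<oplus>\<^bsub>M\<^esub> s \<odot>\<^bsub>M\<^esub> x"
      if "s \<in> carrier (group_ring A)" for s
      using r x that c[of x] by (auto simp: M carrier intro!: B.linear_extension_add)
    show "r \<odot>\<^bsub>M\<^esub> (x \<oplus>\<^bsub>M\<^esub> y) = r \<odot>\<^bsub>M\<^esub> x \<oplus>\<^bsub>M\<^esub> r \<odot>\<^bsub>M\<^esub> y" if y: "y \<in> carrier M" for y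
    proof -
      have "linear_extension B (\<lambda>h. c h (x \<otimes>\<^bsub>B\<^esub> y)) r
          = linear_extension B (\<lambda>h. c h x \<otimes>\<^bsub>B\<^esub> c h y) r"
        by (rule B.linear_extension_cong)
          (use r x y c hom in \<open>auto simp: M carrier hom_def Pi_iff\<close>)
      also have "\<dots> = linear_extension B (\<lambda>h. c h x) r \<otimes>\<^bsub>B\<^esub> linear_extension B (\<lambda>h. c h y) r"
        by (rule B.linear_extension_mult) (use r x y c' in \<open>auto simp: M carrier\<close>)
      finally show ?thesis by (simp add: M)
    qed
    show "(r \<otimes>\<^bsub>group_ring A\<^esub> s) \<odot>\<^bsub>M\<^esub> x = r \<odot>\<^bsub>M\<^esub> (s \<odot>\<^bsub>M\<^esub> x)"
      if s: "s \<in> carrier (group_ring A)" for s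
    proof -
      have r': "Poly_Mapping.keys r \<subseteq> carrier A" and s': "Poly_Mapping.keys s \<subseteq> carrier A"
        and x': "x \<in> carrier B"
        using r s x by (auto simp: M carrier)
      let ?L = "linear_extension B (\<lambda>k. c k x)"
      have keys: "Poly_Mapping.keys (frag_extend (\<lambda>k. frag_of (h \<otimes>\<^bsub>A\<^esub> k)) s) \<subseteq> carrier A"
        if "h \<in> carrier A" for h
        by (rule keys_frag_extend_subset) (use s' that in auto)
      \<comment> \<open>Associativity with a single group element \<open>h\<close> as left factor:
        the action law splits \<open>c\<close> at each product, and \<open>c h\<close>, being a
        homomorphism, moves out of the combination.\<close>
      have inner: "?L (frag_extend (\<lambda>k. frag_of (h \<otimes>\<^bsub>A\<^esub> k)) s) = c h (?L s)"
        if h: "h \<in> carrier A" for h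
      proof -
        have "?L (frag_extend (\<lambda>k. frag_of (h \<otimes>\<^bsub>A\<^esub> k)) s)
            = linear_extension B (\<lambda>k. ?L (frag_of (h \<otimes>\<^bsub>A\<^esub> k))) s"
          by (rule B.linear_extension_frag_extend[OF s' _ c[OF x']]) (use h in auto)
        also have "\<dots> = linear_extension B (\<lambda>k. c h (c k x)) s"
        proof (rule B.linear_extension_cong)
          show "(\<lambda>k. c h (c k x)) \<in> Poly_Mapping.keys s \<rightarrow> carrier B"
            using c c'[OF s' x'] h by blast
          show "?L (frag_of (h \<otimes>\<^bsub>A\<^esub> k)) = c h (c k x)" if "k \<in> Poly_Mapping.keys s" for k
            using c[OF x'] mult[OF h _ x', of k] h s' that
            by (subst B.linear_extension_of) (auto simp: Pi_iff)
        qed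
        also have "\<dots> = c h (?L s)"
          by (rule B.hom_linear_extension[OF hom[OF h] c'[OF s' x'], symmetric])
        finally show ?thesis .
      qed
      \<comment> \<open>The general left factor follows by extending \<open>inner\<close> linearly
        over \<open>r\<close>.\<close>
      have "?L (convolution A r s)
          = linear_extension B (\<lambda>h. ?L (frag_extend (\<lambda>k. frag_of (h \<otimes>\<^bsub>A\<^esub> k)) s)) r"
        by (rule B.linear_extension_frag_extend[OF r' keys c[OF x']])
      also have "\<dots> = linear_extension B (\<lambda>h. c h (?L s)) r"
        by (rule B.linear_extension_cong)
          (use r' inner c'[OF r'] B.linear_extension_closed[OF c'[OF s' x']] in auto)
      finally show ?thesis by (simp add: M carrier)
    qed
  qed
qed

section \<open>Actions induced on quotients\<close>

text \<open>Serves both for automorphisms of \<open>G\<close> acting on the abelianization and for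
  the Torelli group acting on G'/G''. In the second case the elements of \<open>T\<close> are maps
  on all of \<open>G\<close>, so \<open>T\<close> is tied to \<open>A\<close> only by values on its
  carrier.\<close>

lemma quotient_map_hom:
  assumes T: "group T" and N: "N \<lhd> A"
    and hom: "\<And>t. t \<in> carrier T \<Longrightarrow> t \<in> hom A A" and tN: "\<And>t. t \<in> carrier T \<Longrightarrow> t ` N \<subseteq> N"
    and one: "\<And>x. x \<in> carrier A \<Longrightarrow> \<one>\<^bsub>T\<^esub> x = x"
    and mult: "\<And>s t x. s \<in> carrier T \<Longrightarrow> t \<in> carrier T \<Longrightarrow> x \<in> carrier A
      \<Longrightarrow> (s \<otimes>\<^bsub>T\<^esub> t) x = s (t x)"
  shows "quotient_map A N \<in> hom T (AutoGroup (A Mod N))"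
proof -
  interpret T: group T by (rule T)
  interpret N: normal N A by (rule N)
  let ?Q = "A Mod N" and ?q = "quotient_map A N"
  have coset: "?q t (N #>\<^bsub>A\<^esub> x) = N #>\<^bsub>A\<^esub> t x" if "t \<in> carrier T" "x \<in> carrier A" for t x
    using quotient_map_coset[OF N hom tN] that by blast
  have Q: "carrier ?Q = (\<lambda>x. N #>\<^bsub>A\<^esub> x) ` carrier A" by (auto simp: carrier_FactGroup)
  have tA: "t x \<in> carrier A" if "t \<in> carrier T" "x \<in> carrier A" for t x
    using hom that by (auto simp: hom_def)
  have q_mult: "?q (s \<otimes>\<^bsub>T\<^esub> t) K = ?q s (?q t K)"
    if "s \<in> carrier T" "t \<in> carrier T" "K \<in> carrier ?Q" for s t K
    using that by (auto simp: Q coset tA mult)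
  have q_one: "?q \<one>\<^bsub>T\<^esub> K = K" if "K \<in> carrier ?Q" for K
    using that by (auto simp: Q coset one)
  have q_closed: "?q t K \<in> carrier ?Q" if "t \<in> carrier T" "K \<in> carrier ?Q" for t K
    using that by (auto simp: Q coset tA)
  have q_ext: "?q t \<in> extensional (carrier ?Q)" for t
    by (simp add: quotient_map_def)
  have q_hom: "?q t \<in> hom ?Q ?Q" if t: "t \<in> carrier T" for t
  proof (rule homI)
    fix K L assume "K \<in> carrier ?Q" "L \<in> carrier ?Q"
    then obtain x y where xy: "x \<in> carrier A" "K = N #>\<^bsub>A\<^esub> x" "y \<in> carrier A" "L = N #>\<^bsub>A\<^esub> y"
      by (auto simp: Q)
    then show "?q t (K \<otimes>\<^bsub>?Q\<^esub> L) = ?q t K \<otimes>\<^bsub>?Q\<^esub> ?q t L"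
      using t hom[OF t] by (simp add: N.rcos_sum coset tA hom_mult)
  qed (rule q_closed[OF t])
  have q_bij: "bij_betw (?q t) (carrier ?Q) (carrier ?Q)" if t: "t \<in> carrier T" for t
  \<comment> \<open>The inverse map is the one induced by the inverse of \<open>t\<close> in
    \<open>T\<close>.\<close>
  proof (rule bij_betw_byWitness[where f' = "?q (inv\<^bsub>T\<^esub> t)"])
    show "\<forall>K\<in>carrier ?Q. ?q (inv\<^bsub>T\<^esub> t) (?q t K) = K"
      using t by (simp add: q_mult[symmetric] q_one)
    show "\<forall>K\<in>carrier ?Q. ?q t (?q (inv\<^bsub>T\<^esub> t) K) = K"
      using t by (simp add: q_mult[symmetric] q_one)
  qed (use t q_closed in auto)
  have q_Bij: "?q t \<in> Bij (carrier ?Q)" if "t \<in> carrier T" for t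
    using q_bij[OF that] q_ext by (simp add: Bij_def)
  show ?thesis
  proof (rule homI)
    show "?q t \<in> carrier (AutoGroup ?Q)" if "t \<in> carrier T" for t
      using that q_Bij q_hom by (simp add: AutoGroup_def auto_def)
    \<comment> \<open>Agreement on the carrier becomes equality of functions because both sides are
      extensional.\<close>
    show "?q (s \<otimes>\<^bsub>T\<^esub> t) = ?q s \<otimes>\<^bsub>AutoGroup ?Q\<^esub> ?q t" if "s \<in> carrier T" "t \<in> carrier T" for s t
      using that q_Bij q_mult q_ext[of "s \<otimes>\<^bsub>T\<^esub> t"]
      by (auto simp: AutoGroup_def BijGroup_def compose_def intro: extensionalityI)
  qed
qed

section \<open>Automorphism groups and derived subgroups\<close>

lemma carrier_AutoGroup: "carrier (AutoGroup A) = auto A"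
  by (simp add: AutoGroup_def)

lemma mult_AutoGroup:
  "\<lbrakk>s \<in> auto A; t \<in> auto A; x \<in> carrier A\<rbrakk> \<Longrightarrow> (s \<otimes>\<^bsub>AutoGroup A\<^esub> t) x = s (t x)"
  by (simp add: AutoGroup_def BijGroup_def auto_def compose_eq)

lemma one_AutoGroup: "x \<in> carrier A \<Longrightarrow> \<one>\<^bsub>AutoGroup A\<^esub> x = x"
  by (simp add: AutoGroup_def BijGroup_def)

text \<open>The image of a derived subgroup under a homomorphism is the derived subgroup of the
  image. Surjectivity gives the first claim, and the first claim gives the second.\<close>

lemma (in group) derived_auto_image:
  assumes \<alpha>: "\<alpha> \<in> auto G"
  shows "\<alpha> ` derived_subgroup G = derived_subgroup G"
    and "\<alpha> ` second_derived_subgroup G = second_derived_subgroup G"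
proof -
  have "\<alpha> \<in> hom G G" and surj: "\<alpha> ` carrier G = carrier G"
    using \<alpha> by (auto simp: auto_def Bij_def bij_betw_def)
  then interpret h: group_hom G G \<alpha> by unfold_locales
  show *: "\<alpha> ` derived_subgroup G = derived_subgroup G"
    using h.derived_img[of "carrier G"] surj by simp
  show "\<alpha> ` second_derived_subgroup G = second_derived_subgroup G"
    using h.derived_img[of "derived_subgroup G"] * derived_in_carrier[of "carrier G"] by simp
qed

text \<open>Makes the kernel in \<open>Torelli_group\<close> the kernel of a homomorphism, hence a
  subgroup.\<close>

lemma (in group) Torelli_quotient_map_hom:
  "quotient_map G (derived_subgroup G) \<in> hom (AutoGroup G) (AutoGroup (abelianization G))"
  unfolding abelianization_def
  by (rule quotient_map_hom[OF AutoGroup derived_self_is_normal])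
    (auto simp: carrier_AutoGroup one_AutoGroup mult_AutoGroup derived_auto_image auto_def[of G])

section \<open>The Alexander invariant\<close>

context group
begin

lemma derived_subgroup_normal: "second_derived_subgroup G \<lhd> G\<lparr>carrier := derived_subgroup G\<rparr>"
  by (rule derived_subgroup_is_normal[OF derived_is_subgroup]) simp

text \<open>Cosets depend only on the multiplication, which G' shares with \<open>G\<close>, so they
  may be written in \<open>G\<close>.\<close>

lemma carrier_Alexander_quotient:
  "carrier (Alexander_quotient G) = (\<lambda>g. second_derived_subgroup G #> g) ` derived_subgroup G"
  by (auto simp: Alexander_quotient_def carrier_FactGroup r_coset_def)

lemma Alexander_quotient_mult_coset:
  assumes "x \<in> derived_subgroup G" "y \<in> derived_subgroup G"
  shows "(second_derived_subgroup G #> x) \<otimes>\<^bsub>Alexander_quotient G\<^esub> (second_derived_subgroup G #> y)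
    = second_derived_subgroup G #> (x \<otimes> y)"
  using normal.rcos_sum[OF derived_subgroup_normal, of x y] assms
  by (simp add: Alexander_quotient_def r_coset_def)

lemma comm_group_Alexander_quotient: "comm_group (Alexander_quotient G)"
  unfolding Alexander_quotient_def
  by (rule derived_quot_of_subgroup_is_comm_group[OF derived_is_subgroup]) simp

lemma carrier_abelianization:
  "carrier (abelianization G) = (\<lambda>h. derived_subgroup G #> h) ` carrier G"
  by (auto simp: abelianization_def carrier_FactGroup)

lemma derived_subgroup_carrier: "x \<in> derived_subgroup G \<Longrightarrow> x \<in> carrier G"
  using derived_in_carrier[of "carrier G"] by blast

lemma derived_subgroup_conj:
  "\<lbrakk>h \<in> carrier G; g \<in> derived_subgroup G\<rbrakk> \<Longrightarrow> h \<otimes> g \<otimes> inv h \<in> derived_subgroup G"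
  by (rule normal.inv_op_closed2[OF derived_self_is_normal])

lemma derived_subgroup_mult:
  "\<lbrakk>x \<in> derived_subgroup G; y \<in> derived_subgroup G\<rbrakk> \<Longrightarrow> x \<otimes> y \<in> derived_subgroup G"
  by (rule subgroup.m_closed[OF derived_is_subgroup]) auto

section \<open>The conjugation action of the abelianization on G'/G''\<close>

lemma conj_class_hom:
  assumes "H \<in> carrier (abelianization G)"
  shows "conj_class G H \<in> hom (Alexander_quotient G) (Alexander_quotient G)"
proof -
  obtain h where h: "h \<in> carrier G" "H = derived_subgroup G #> h"
    using assms by (auto simp: carrier_abelianization)
  note conj = conj_class_coset[OF is_group h(1)]
  show ?thesis
  proof (rule homI)
    show "conj_class G H K \<in> carrier (Alexander_quotient G)" if "K \<in> carrier (Alexander_quotient G)" for K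
      using that h derived_subgroup_conj by (auto simp: carrier_Alexander_quotient conj)
    fix K L assume "K \<in> carrier (Alexander_quotient G)" "L \<in> carrier (Alexander_quotient G)"
    then obtain x y where x: "x \<in> derived_subgroup G" "K = second_derived_subgroup G #> x"
      and y: "y \<in> derived_subgroup G" "L = second_derived_subgroup G #> y"
      by (auto simp: carrier_Alexander_quotient)
    have xy: "x \<in> carrier G" "y \<in> carrier G"
      using x(1) y(1) by (auto dest: derived_subgroup_carrier)
    \<comment> \<open>The cancellation in the middle of a product of two conjugates, in the
      right-nested form that \<open>m_assoc\<close> produces.\<close>
    then have "inv h \<otimes> (h \<otimes> (y \<otimes> inv h)) = y \<otimes> inv h"
      using h(1) m_assoc[of "inv h" h "y \<otimes> inv h"] by simp
    then have "h \<otimes> (x \<otimes> y) \<otimes> inv h = (h \<otimes> x \<otimes> inv h) \<otimes> (h \<otimes> y \<otimes> inv h)"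
      using h(1) xy by (simp add: m_assoc)
    then show "conj_class G H (K \<otimes>\<^bsub>Alexander_quotient G\<^esub> L)
        = conj_class G H K \<otimes>\<^bsub>Alexander_quotient G\<^esub> conj_class G H L"
      using x y h derived_subgroup_mult derived_subgroup_conj
      by (simp add: Alexander_quotient_mult_coset conj)
  qed
qed

lemma conj_class_one:
  assumes "K \<in> carrier (Alexander_quotient G)"
  shows "conj_class G \<one>\<^bsub>abelianization G\<^esub> K = K"
proof -
  have "\<one>\<^bsub>abelianization G\<^esub> = derived_subgroup G #> \<one>"
    by (simp add: abelianization_def derived_in_carrier)
  then show ?thesis
    using assms conj_class_coset[OF is_group one_closed]
    by (auto simp: carrier_Alexander_quotient derived_subgroup_carrier)
qed

lemma conj_class_mult:
  assumes "H \<in> carrier (abelianization G)" "H' \<in> carrier (abelianization G)"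
    "K \<in> carrier (Alexander_quotient G)"
  shows "conj_class G (H \<otimes>\<^bsub>abelianization G\<^esub> H') K = conj_class G H (conj_class G H' K)"
proof -
  obtain h h' g where h: "h \<in> carrier G" "H = derived_subgroup G #> h"
    and h': "h' \<in> carrier G" "H' = derived_subgroup G #> h'"
    and g: "g \<in> derived_subgroup G" "K = second_derived_subgroup G #> g"
    using assms by (auto simp: carrier_abelianization carrier_Alexander_quotient)
  have "H \<otimes>\<^bsub>abelianization G\<^esub> H' = derived_subgroup G #> (h \<otimes> h')"
    using h h' normal.rcos_sum[OF derived_self_is_normal] by (simp add: abelianization_def)
  moreover have "h \<otimes> h' \<otimes> g \<otimes> inv (h \<otimes> h') = h \<otimes> (h' \<otimes> g \<otimes> inv h') \<otimes> inv h"
    using h h' g derived_subgroup_carrier by (simp add: m_assoc inv_mult_group)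
  ultimately show ?thesis
    using h h' g derived_subgroup_conj by (simp add: conj_class_coset[OF is_group])
qed

section \<open>The module structure over the group ring\<close>

lemma Alexander_invariant_sel:
  "carrier (Alexander_invariant G) = carrier (Alexander_quotient G)"
  "\<zero>\<^bsub>Alexander_invariant G\<^esub> = \<one>\<^bsub>Alexander_quotient G\<^esub>"
  "add (Alexander_invariant G) = monoid.mult (Alexander_quotient G)"
  "r \<odot>\<^bsub>Alexander_invariant G\<^esub> K = linear_extension (Alexander_quotient G) (\<lambda>H. conj_class G H K) r"
  by (simp_all add: Alexander_invariant_def Let_def linear_extension_def)

lemma module_Alexander_invariant: "module (group_ring (abelianization G)) (Alexander_invariant G)"
proof (rule module_group_ring[where c = "conj_class G" and B = "Alexander_quotient G"])
  show "comm_group (abelianization G)"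
    unfolding abelianization_def by (rule derived_quot_is_comm_group)
qed (simp_all add: Alexander_invariant_sel comm_group_Alexander_quotient conj_class_hom
      conj_class_one conj_class_mult)

section \<open>The Torelli group\<close>

lemma Torelli_group_hom:
  "group_hom (AutoGroup G) (AutoGroup (abelianization G)) (quotient_map G (derived_subgroup G))"
proof -
  interpret Q: group "abelianization G"
    unfolding abelianization_def by (rule derived_quot_is_group)
  show ?thesis
    using AutoGroup Q.AutoGroup Torelli_quotient_map_hom
    by (simp add: group_hom_def group_hom_axioms_def)
qed

lemma group_Torelli_group: "group (Torelli_group G)"
  unfolding Torelli_group_def
  by (rule subgroup.subgroup_is_group[OF group_hom.subgroup_kernel[OF Torelli_group_hom] AutoGroup])

lemma Torelli_group_auto: "t \<in> carrier (Torelli_group G) \<Longrightarrow> t \<in> auto G"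
  by (simp add: Torelli_group_def kernel_def carrier_AutoGroup)

text \<open>Evaluates the induced map, which is the identity by membership in the kernel, at the
  coset of \<open>h\<close>. The equivariance proof uses triviality on the abelianization in this
  form.\<close>

lemma Torelli_group_fixes_coset:
  assumes "t \<in> carrier (Torelli_group G)" "h \<in> carrier G"
  shows "derived_subgroup G #> t h = derived_subgroup G #> h"
proof -
  have t: "t \<in> auto G" by (rule Torelli_group_auto[OF assms(1)])
  have "quotient_map G (derived_subgroup G) t (derived_subgroup G #> h) = derived_subgroup G #> t h"
    by (rule quotient_map_coset[OF derived_self_is_normal])
      (use t assms derived_auto_image in \<open>auto simp: auto_def\<close>)
  moreover have "quotient_map G (derived_subgroup G) t = \<one>\<^bsub>AutoGroup (abelianization G)\<^esub>"
    using assms(1) by (simp add: Torelli_group_def kernel_def)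
  ultimately show ?thesis
    using assms(2) by (simp add: one_AutoGroup carrier_abelianization)
qed

section \<open>The Torelli action on the Alexander invariant\<close>

lemma Alexander_action_hom:
  "Alexander_action G \<in> hom (Torelli_group G) (AutoGroup (Alexander_quotient G))"
  unfolding Alexander_action_def Alexander_quotient_def
proof (rule quotient_map_hom[OF group_Torelli_group derived_subgroup_normal])
  fix t assume t: "t \<in> carrier (Torelli_group G)"
  note image = derived_auto_image[OF Torelli_group_auto[OF t]]
  show "t ` second_derived_subgroup G \<subseteq> second_derived_subgroup G"
    using image by simp
  have "t \<in> hom G G"
    using Torelli_group_auto[OF t] by (simp add: auto_def)
  then show "t \<in> hom (G\<lparr>carrier := derived_subgroup G\<rparr>) (G\<lparr>carrier := derived_subgroup G\<rparr>)"
    using image(1) derived_subgroup_carrier by (auto simp: hom_def)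
qed (auto simp: Torelli_group_def kernel_def carrier_AutoGroup mult_AutoGroup one_AutoGroup
      derived_subgroup_carrier)

lemma Alexander_action_mem_auto:
  "t \<in> carrier (Torelli_group G) \<Longrightarrow> Alexander_action G t \<in> auto (Alexander_quotient G)"
  using Alexander_action_hom by (auto simp: hom_def carrier_AutoGroup)

lemma Alexander_action_conj_class:
  assumes t: "t \<in> carrier (Torelli_group G)" and "H \<in> carrier (abelianization G)"
    and "K \<in> carrier (Alexander_quotient G)"
  shows "Alexander_action G t (conj_class G H K) = conj_class G H (Alexander_action G t K)"
proof -
  obtain h g where h: "h \<in> carrier G" "H = derived_subgroup G #> h"
    and g: "g \<in> derived_subgroup G" "K = second_derived_subgroup G #> g"
    using assms by (auto simp: carrier_abelianization carrier_Alexander_quotient)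
  have auto: "t \<in> auto G" by (rule Torelli_group_auto[OF t])
  interpret t: group_hom G G t
    by unfold_locales (use auto in \<open>simp add: auto_def\<close>)
  have tg: "t g \<in> derived_subgroup G"
    using derived_auto_image(1)[OF auto] g(1) by blast
  have "Alexander_action G t (conj_class G H K)
      = second_derived_subgroup G #> t (h \<otimes> g \<otimes> inv h)"
    using h g by (simp add: conj_class_coset[OF is_group] Alexander_action_coset[OF is_group auto]
        derived_subgroup_conj)
  also have "\<dots> = second_derived_subgroup G #> (t h \<otimes> t g \<otimes> inv (t h))"
    using h(1) derived_subgroup_carrier[OF g(1)] by simp
  also have "\<dots> = conj_class G (derived_subgroup G #> t h) (second_derived_subgroup G #> t g)"
    by (rule conj_class_coset[OF is_group _ tg, symmetric]) (use h(1) in simp)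
  \<comment> \<open>Here the Torelli condition enters: \<open>t h\<close> and \<open>h\<close> have
    the same class \<open>H\<close>.\<close>
  also have "\<dots> = conj_class G H (Alexander_action G t K)"
    using h g by (simp add: Torelli_group_fixes_coset[OF t] Alexander_action_coset[OF is_group auto])
  finally show ?thesis .
qed

text \<open>The induced automorphism passes inside the linear combination, and there it commutes
  with each \<open>conj_class G H\<close> for \<open>H\<close> in the support of
  \<open>r\<close>.\<close>

lemma Alexander_action_smult:
  assumes t: "t \<in> carrier (Torelli_group G)" and r: "r \<in> carrier (group_ring (abelianization G))"
    and K: "K \<in> carrier (Alexander_invariant G)"
  shows "Alexander_action G t (r \<odot>\<^bsub>Alexander_invariant G\<^esub> K)
    = r \<odot>\<^bsub>Alexander_invariant G\<^esub> Alexander_action G t K"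
proof -
  interpret B: comm_group "Alexander_quotient G" by (rule comm_group_Alexander_quotient)
  have hom: "Alexander_action G t \<in> hom (Alexander_quotient G) (Alexander_quotient G)"
    using Alexander_action_mem_auto[OF t] by (simp add: auto_def)
  have K': "K \<in> carrier (Alexander_quotient G)" using K by (simp add: Alexander_invariant_sel)
  then have tK: "Alexander_action G t K \<in> carrier (Alexander_quotient G)"
    using hom by (auto simp: hom_def)
  have r': "Poly_Mapping.keys r \<subseteq> carrier (abelianization G)" using r by (simp add: group_ring_def)
  have closed: "(\<lambda>H. conj_class G H L) \<in> Poly_Mapping.keys r \<rightarrow> carrier (Alexander_quotient G)"
    if "L \<in> carrier (Alexander_quotient G)" for L
    using conj_class_hom r' that by (fastforce simp: hom_def)
  have "Alexander_action G t (linear_extension (Alexander_quotient G) (\<lambda>H. conj_class G H K) r)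
      = linear_extension (Alexander_quotient G) (\<lambda>H. Alexander_action G t (conj_class G H K)) r"
    by (rule B.hom_linear_extension[OF hom closed[OF K']])
  also have "\<dots> = linear_extension (Alexander_quotient G)
      (\<lambda>H. conj_class G H (Alexander_action G t K)) r"
    by (rule B.linear_extension_cong[OF closed[OF tK]])
      (use r' Alexander_action_conj_class[OF t _ K'] in blast)
  finally show ?thesis by (simp add: Alexander_invariant_sel)
qed

text \<open>\<open>AutoGroup\<close> has the multiplication of \<open>BijGroup\<close>, so a
  homomorphism into the former is also one into the latter, as \<open>group_action\<close>
  demands.\<close>

lemma group_action_Alexander_action:
  "group_action (Torelli_group G) (carrier (Alexander_invariant G)) (Alexander_action G)"
proof -
  have "Alexander_action G \<in> hom (Torelli_group G) (BijGroup (carrier (Alexander_quotient G)))"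
    using Alexander_action_hom by (auto simp: hom_def AutoGroup_def BijGroup_def auto_def)
  then show ?thesis
    by (simp add: group_action_def group_hom_def group_hom_axioms_def group_Torelli_group
        group_BijGroup Alexander_invariant_sel)
qed

end

theorem proposition5p3:
  fixes G :: "('a, 'b) monoid_scheme"
  assumes "group G"
  shows "acts_linearly (Torelli_group G) (group_ring (abelianization G))
           (Alexander_invariant G) (Alexander_action G)"
proof -
  interpret group G by (rule assms)
  \<comment> \<open>Addition in the module is multiplication in G'/G'', which the induced
    automorphism preserves.\<close>
  have "Alexander_action G t (x \<oplus>\<^bsub>Alexander_invariant G\<^esub> y)
      = Alexander_action G t x \<oplus>\<^bsub>Alexander_invariant G\<^esub> Alexander_action G t y"
    if "t \<in> carrier (Torelli_group G)" "x \<in> carrier (Alexander_invariant G)"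
      "y \<in> carrier (Alexander_invariant G)" for t x y
    using Alexander_action_mem_auto[of t] that by (simp add: Alexander_invariant_sel auto_def hom_mult)
  then show ?thesis
    unfolding acts_linearly_def
    using module_Alexander_invariant group_action_Alexander_action Alexander_action_smult by blast
qed

end
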